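(* Let $k \ge 2$, $n\ge 1$ and let $\mathcal{A} = (a_{i_1\cdots i_k})$ be a $k$th order $n$-dimensional nonnegative tensor (not necessarily symmetric). Let $\lambda_{\max}(\mathcal{A})$ denote the largest H-eigenvalue of $\mathcal{A}$. Then $$\lambda_{\max}(\mathcal{A}) \le R_{\max}(\mathcal{A}).$$ If furthermore $\mathcal{A}$ is symmetric, then $$\lambda_{\max}(\mathcal{A}) \ge \max \{ \bar R(\mathcal{A}),\ d_{\max}(\mathcal{A}) \}.$$
   Context: A real $k$th order $n$-dimensional tensor is an array $\mathcal{A}=(a_{i_1\cdots i_k})$ of real numbers, $i_1,\dots,i_k\in\{1,\dots,n\}$. It is symmetric if its entries are invariant under every permutation of the indices, and nonnegative if all its entries are nonnegative. For a vector $x$, $\mathcal{A}x^{k-1}$ is the $n$-dimensional vector with $i$th component $(\mathcal{A}x^{k-1})_i=\sum_{i_2,\dots,i_k=1}^n a_{ii_2\cdots i_k}x_{i_2}\cdots x_{i_k}$, and $x^{[k-1]}$ is the vector with $i$th component $x_i^{k-1}$. A real number $\lambda$ is an H-eigenvalue of $\mathcal{A}$ if there is a real nonzero vector $x\in\mathbb{R}^n$ with $\mathcal{A}x^{k-1}=\lambda x^{[k-1]}$. (A nonnegative tensor always has a largest H-eigenvalue, by the known Perron–Frobenius theorem for nonnegative tensors.) The $i$th row sum is $R_i(\mathcal{A})=\sum_{i_2,\dots,i_k=1}^n a_{ii_2\cdots i_k}$; $R_{\max}(\mathcal{A})=\max_{1\le i\le n}R_i(\mathcal{A})$; $\bar R(\mathcal{A})=\frac1n\sum_{i=1}^n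 R_i(\mathcal{A})$; $d_{\max}(\mathcal{A})=\max_{1\le i\le n}a_{i\cdots i}$ is the largest diagonal element. *)

theory Defs
  imports "HOL-Analysis.Analysis" "HOL-Combinatorics.Permutations"
begin

text \<open>
  The entry \<open>a\<close> with multi-index \<open>(i\<^sub>1, \<dots>, i\<^sub>k)\<close> of a tensor of order \<open>k\<close> and dimension
  \<open>CARD('n)\<close> is the value at the list \<open>[i\<^sub>1, \<dots>, i\<^sub>k]\<close>. The order is passed as a separate
  argument; values at lists of any other length are never used.
\<close>

type_synonym 'n tensor = "'n list \<Rightarrow> real"

definition nonneg_tensor :: "nat \<Rightarrow> 'n tensor \<Rightarrow> bool" where
  "nonneg_tensor k A \<longleftrightarrow> (\<forall>is. length is = k \<longrightarrow> 0 \<le> A is)"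

definition symmetric_tensor :: "nat \<Rightarrow> 'n tensor \<Rightarrow> bool" where
  "symmetric_tensor k A \<longleftrightarrow>
     (\<forall>is \<pi>. length is = k \<longrightarrow> \<pi> permutes {..<k} \<longrightarrow> A (permute_list \<pi> is) = A is)"

definition tensor_apply :: "nat \<Rightarrow> 'n::finite tensor \<Rightarrow> real ^ 'n \<Rightarrow> real ^ 'n" where
  "tensor_apply k A x = (\<chi> i. \<Sum>js | length js = k - 1. A (i # js) * (\<Prod>j\<leftarrow>js. x $ j))"

definition vec_power :: "real ^ 'n \<Rightarrow> nat \<Rightarrow> real ^ 'n" where
  "vec_power x m = (\<chi> i. (x $ i) ^ m)"

definition H_eigenvalue :: "nat \<Rightarrow> 'n::finite tensor \<Rightarrow> real \<Rightarrow> bool" where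
  "H_eigenvalue k A \<mu> \<longleftrightarrow>
     (\<exists>x. x \<noteq> 0 \<and> tensor_apply k A x = \<mu> *\<^sub>R vec_power x (k - 1))"

text \<open>
  Meaningful only when a largest H-eigenvalue exists, as it does for every nonnegative tensor
  of order at least 2 by the Perron--Frobenius theorem.
\<close>

definition lambda_max :: "nat \<Rightarrow> 'n::finite tensor \<Rightarrow> real" where
  "lambda_max k A = (GREATEST \<mu>. H_eigenvalue k A \<mu>)"

definition row_sum :: "nat \<Rightarrow> 'n::finite tensor \<Rightarrow> 'n \<Rightarrow> real" where
  "row_sum k A i = (\<Sum>js | length js = k - 1. A (i # js))"

definition max_row_sum :: "nat \<Rightarrow> 'n::finite tensor \<Rightarrow> real" where
  "max_row_sum k A = (MAX i. row_sum k A i)"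

definition avg_row_sum :: "nat \<Rightarrow> 'n::finite tensor \<Rightarrow> real" where
  "avg_row_sum k (A :: 'n tensor) = (\<Sum>i\<in>UNIV. row_sum k A i) / real CARD('n)"

definition max_diag :: "nat \<Rightarrow> 'n::finite tensor \<Rightarrow> real" where
  "max_diag k A = (MAX i. A (replicate k i))"

end

theory Submission
  imports Defs
begin

text \<open>
  Brouwer's theorem, applied on the standard simplex to the normalised componentwise \<open>(k - 1)\<close>st root
  of \<open>A x\<^bsup>k-1\<^esup> + \<epsilon>\<close>, gives a positive \<open>x\<close> and a \<open>\<mu>\<close> with \<open>A x\<^bsup>k-1\<^esup> + \<epsilon> = \<mu> x\<^bsup>[k-1]\<^esup>\<close>. As
  \<open>\<epsilon> \<rightarrow> 0\<close>, a subsequence converges to an H-eigenpair, so H-eigenvalues exist. They form a compact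
  set (normalise the eigenvectors) bounded by the largest row sum (look at a coordinate of the
  eigenvector of largest modulus), so a largest one exists. If \<open>A\<close> is symmetric, the inequality of
  arithmetic and geometric means for the ratios \<open>z\<^sub>i / x\<^sub>i\<close> yields \<open>A z\<^bsup>k\<^esup> \<le> \<mu> (\<Sum>i. z\<^sub>i\<^bsup>k\<^esup>)\<close> for all
  \<open>z \<ge> 0\<close>, and this survives the limit \<open>\<epsilon> \<rightarrow> 0\<close>. The all-ones vector and the unit vectors then give
  the two lower bounds.
\<close>

section \<open>Sums and products over multi-indices\<close>

lemma finite_lists_length [simp]: "finite {xs :: 'n::finite list. length xs = m}"
  using finite_lists_length_eq[of "UNIV :: 'n set" m] by simp

lemma sum_lists_Suc:
  fixes f :: "'n::finite list \<Rightarrow> real"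
  shows "(\<Sum>is | length is = Suc m. f is) = (\<Sum>i\<in>UNIV. \<Sum>js | length js = m. f (i # js))"
proof -
  have "(\<Sum>i\<in>UNIV. \<Sum>js | length js = m. f (i # js))
      = (\<Sum>(i, js)\<in>UNIV \<times> {js. length js = m}. f (i # js))"
    by (simp add: sum.cartesian_product)
  also have "\<dots> = (\<Sum>is | length is = Suc m. f is)"
    by (rule sum.reindex_bij_witness[where i = "\<lambda>is. (hd is, tl is)" and j = "\<lambda>(i, js). i # js"])
      (auto simp: length_Suc_conv)
  finally show ?thesis by simp
qed

lemma prod_list_map_mult:
  fixes f g :: "'a \<Rightarrow> 'b::comm_monoid_mult"
  shows "(\<Prod>x\<leftarrow>xs. f x * g x) = (\<Prod>x\<leftarrow>xs. f x) * (\<Prod>x\<leftarrow>xs. g x)"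
  by (induction xs) (simp_all add: ac_simps)

lemma prod_list_map_const_mult:
  fixes c :: "'b::comm_monoid_mult"
  shows "(\<Prod>x\<leftarrow>xs. c * f x) = c ^ length xs * (\<Prod>x\<leftarrow>xs. f x)"
  by (induction xs) (simp_all add: ac_simps)

lemma prod_list_map_nonneg:
  fixes f :: "'a \<Rightarrow> real"
  assumes "\<And>x. x \<in> set xs \<Longrightarrow> 0 \<le> f x"
  shows "0 \<le> (\<Prod>x\<leftarrow>xs. f x)"
  using assms by (induction xs) simp_all

lemma abs_prod_list_map_le_power:
  fixes f :: "'a \<Rightarrow> real"
  assumes "\<And>x. x \<in> set xs \<Longrightarrow> \<bar>f x\<bar> \<le> c"
  shows "\<bar>\<Prod>x\<leftarrow>xs. f x\<bar> \<le> c ^ length xs"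
  using assms
proof (induction xs)
  case (Cons a xs)
  then have "\<bar>f a\<bar> \<le> c" "0 \<le> c" by (auto intro: order_trans[OF abs_ge_zero])
  with Cons show ?case by (auto simp: abs_mult intro!: mult_mono)
qed simp

text \<open>Arithmetic-geometric mean inequality for the numbers
  \<open>f (xs ! j) ^ length xs\<close>, whose geometric mean is the product on the left.\<close>

lemma prod_list_map_le_mean_power:
  fixes f :: "'a \<Rightarrow> real"
  assumes "xs \<noteq> []" and nonneg: "\<And>x. 0 \<le> f x"
  shows "(\<Prod>x\<leftarrow>xs. f x) \<le> (\<Sum>j<length xs. f (xs ! j) ^ length xs) / length xs"
proof -
  let ?k = "length xs"
  let ?P = "\<Prod>j<?k. f (xs ! j)"
  have "?k > 0" using assms by simp
  have "0 \<le> ?P" using nonneg by (simp add: prod_nonneg)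
  then have "?P = (?P ^ ?k) powr (1 / ?k)"
  \<comment> \<open>Powers agree with \<open>powr\<close> only for a positive base, so a vanishing
    product is treated apart.\<close>
  proof (cases "?P = 0")
    case True
    then show ?thesis using \<open>?k > 0\<close> by (simp only:) simp
  next
    case False
    with \<open>0 \<le> ?P\<close> have "?P ^ ?k = ?P powr ?k" by (intro powr_realpow[symmetric]) linarith
    then show ?thesis using \<open>0 \<le> ?P\<close> \<open>?k > 0\<close> by (simp only: powr_powr) simp
  qed
  also have "\<dots> \<le> (\<Sum>j<?k. f (xs ! j) ^ ?k) / ?k"
    using arith_geom_mean[of "{..<?k}" "\<lambda>j. f (xs ! j) ^ ?k"] assms
    by (simp add: lessThan_empty_iff sum_divide_distrib prod_power_distrib)
  also have "?P = (\<Prod>x\<leftarrow>xs. f x)"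
    by (simp add: prod.list_conv_set_nth atLeast0LessThan)
  finally show ?thesis .
qed

section \<open>Continuity and homogeneity of the tensor map\<close>

lemma continuous_on_prod_list_map:
  fixes f :: "'a \<Rightarrow> 'b::topological_space \<Rightarrow> real"
  assumes "\<And>x. continuous_on S (f x)"
  shows "continuous_on S (\<lambda>y. \<Prod>x\<leftarrow>xs. f x y)"
  using assms by (induction xs) (auto intro!: continuous_intros)

lemma continuous_on_tensor_apply [continuous_intros]:
  assumes "continuous_on S f"
  shows "continuous_on S (\<lambda>y. tensor_apply k A (f y))"
  unfolding tensor_apply_def
  by (intro continuous_on_vec_lambda continuous_on_sum continuous_on_mult continuous_on_const
      continuous_on_prod_list_map continuous_on_component assms)

lemma continuous_on_vec_power [continuous_intros]:
  assumes "continuous_on S f"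
  shows "continuous_on S (\<lambda>y. vec_power (f y) m)"
  unfolding vec_power_def
  by (intro continuous_on_vec_lambda continuous_on_power continuous_on_component assms)

lemma tensor_apply_scaleR:
  "tensor_apply k A (c *\<^sub>R x) = c ^ (k - 1) *\<^sub>R tensor_apply k A x"
  by (auto simp: tensor_apply_def vec_eq_iff prod_list_map_const_mult sum_distrib_left
      intro!: sum.cong)

lemma vec_power_scaleR: "vec_power (c *\<^sub>R x) m = c ^ m *\<^sub>R vec_power x m"
  by (simp add: vec_power_def vec_eq_iff power_mult_distrib)

section \<open>Row sum bounds and compactness of the set of H-eigenvalues\<close>

lemma nonneg_tensor_Cons:
  assumes "nonneg_tensor k A" "k \<ge> 1" "length js = k - 1"
  shows "0 \<le> A (i # js)"
  using assms by (simp add: nonneg_tensor_def)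

lemma abs_tensor_apply_le:
  assumes "nonneg_tensor k A" "k \<ge> 1" and "\<And>j. \<bar>x $ j\<bar> \<le> c"
  shows "\<bar>tensor_apply k A x $ i\<bar> \<le> row_sum k A i * c ^ (k - 1)"
proof -
  have "\<bar>tensor_apply k A x $ i\<bar> \<le> (\<Sum>js | length js = k - 1. \<bar>A (i # js) * (\<Prod>j\<leftarrow>js. x $ j)\<bar>)"
    by (simp add: tensor_apply_def)
  also have "\<dots> \<le> (\<Sum>js | length js = k - 1. A (i # js) * c ^ (k - 1))"
  proof (rule sum_mono)
    fix js :: "'a list" assume "js \<in> {js. length js = k - 1}"
    then show "\<bar>A (i # js) * (\<Prod>j\<leftarrow>js. x $ j)\<bar> \<le> A (i # js) * c ^ (k - 1)"
      using nonneg_tensor_Cons[OF assms(1,2)] abs_prod_list_map_le_power[of js "\<lambda>j. x $ j" c] assms(3)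
      by (auto simp: abs_mult intro!: mult_left_mono)
  qed
  finally show ?thesis by (simp add: row_sum_def sum_distrib_right)
qed

lemma tensor_apply_nonneg:
  assumes "nonneg_tensor k A" "k \<ge> 1" and "\<And>j. 0 \<le> x $ j"
  shows "0 \<le> tensor_apply k A x $ i"
  using assms nonneg_tensor_Cons[OF assms(1,2)]
  by (auto simp: tensor_apply_def intro!: sum_nonneg mult_nonneg_nonneg prod_list_map_nonneg)

lemma row_sum_le_max_row_sum: "row_sum k A i \<le> max_row_sum k A"
  by (simp add: max_row_sum_def)

text \<open>Bounding the modulus serves twice: it gives the upper bound of the theorem and confines
  the H-eigenvalues to an interval.\<close>

lemma abs_H_eigenvalue_le_max_row_sum:
  assumes "nonneg_tensor k A" "k \<ge> 1" "H_eigenvalue k A \<mu>"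
  shows "\<bar>\<mu>\<bar> \<le> max_row_sum k A"
proof -
  obtain x where "x \<noteq> 0" and eig: "tensor_apply k A x = \<mu> *\<^sub>R vec_power x (k - 1)"
    using assms by (auto simp: H_eigenvalue_def)
  let ?c = "MAX j. \<bar>x $ j\<bar>"
  have le: "\<bar>x $ j\<bar> \<le> ?c" for j by simp
  have "?c \<in> range (\<lambda>j. \<bar>x $ j\<bar>)" by (rule Max_in) auto
  then obtain i where i: "\<bar>x $ i\<bar> = ?c" by (metis imageE)
  obtain j where "x $ j \<noteq> 0" using \<open>x \<noteq> 0\<close> by (auto simp: vec_eq_iff)
  then have "?c > 0" using le[of j] by linarith
  \<comment> \<open>At the coordinate \<open>i\<close> of largest modulus, the eigenvalue equation
    and the row sum estimate both carry the positive factor \<open>?c ^ (k - 1)\<close>, which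
    cancels.\<close>
  have "\<bar>\<mu>\<bar> * ?c ^ (k - 1) = \<bar>tensor_apply k A x $ i\<bar>"
    using i by (simp add: eig vec_power_def abs_mult power_abs)
  also have "\<dots> \<le> row_sum k A i * ?c ^ (k - 1)"
    by (rule abs_tensor_apply_le[OF assms(1,2) le])
  finally have "\<bar>\<mu>\<bar> \<le> row_sum k A i"
    using \<open>?c > 0\<close> by simp
  then show ?thesis using row_sum_le_max_row_sum order_trans by blast
qed

text \<open>The set is the projection to the second factor of a closed part of the compact product
  of the unit sphere with an interval.\<close>

lemma compact_H_eigenvalues:
  assumes "nonneg_tensor k A" "k \<ge> 1"
  shows "compact {\<mu>. H_eigenvalue k A \<mu>}"
proof -
  let ?R = "max_row_sum k A"
  let ?K = "(sphere 0 1 \<times> {-?R..?R}) \<inter>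
    {p. tensor_apply k A (fst p) = snd p *\<^sub>R vec_power (fst p) (k - 1)}"
  have "closed {p. tensor_apply k A (fst p) = snd p *\<^sub>R vec_power (fst p) (k - 1)}"
    by (intro closed_Collect_eq continuous_intros)
  then have "compact ?K"
    by (intro compact_Int_closed compact_Times) simp_all
  then have "compact (snd ` ?K)"
    by (intro compact_continuous_image continuous_intros)
  also have "snd ` ?K = {\<mu>. H_eigenvalue k A \<mu>}"
  proof (intro equalityI subsetI)
    fix \<mu> assume "\<mu> \<in> snd ` ?K"
    then obtain x where "norm x = 1" "tensor_apply k A x = \<mu> *\<^sub>R vec_power x (k - 1)"
      by auto
    then show "\<mu> \<in> {\<mu>. H_eigenvalue k A \<mu>}"
      unfolding H_eigenvalue_def by (intro CollectI exI[of _ x]) auto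
  next
    fix \<mu> assume "\<mu> \<in> {\<mu>. H_eigenvalue k A \<mu>}"
    then have H: "H_eigenvalue k A \<mu>" by simp
    then obtain x where "x \<noteq> 0" and eig: "tensor_apply k A x = \<mu> *\<^sub>R vec_power x (k - 1)"
      by (auto simp: H_eigenvalue_def)
    \<comment> \<open>Both sides of the eigenvalue equation are homogeneous of degree
      \<open>k - 1\<close>, so normalising \<open>x\<close> keeps \<open>\<mu>\<close>.\<close>
    then have "(inverse (norm x) *\<^sub>R x, \<mu>) \<in> ?K"
      using abs_H_eigenvalue_le_max_row_sum[OF assms H]
      by (auto simp: tensor_apply_scaleR vec_power_scaleR abs_le_iff)
    then show "\<mu> \<in> snd ` ?K" by force
  qed
  finally show ?thesis .
qed

section \<open>Brouwer's theorem and the perturbed equation\<close>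

text \<open>Normalising by the coordinate sum makes the domain convex, as Brouwer's theorem
  requires, and still excludes \<open>0\<close>.\<close>

definition std_simplex :: "(real ^ 'n::finite) set" where
  "std_simplex = {x. (\<forall>i. 0 \<le> x $ i) \<and> (\<Sum>i\<in>UNIV. x $ i) = 1}"

lemma std_simplex_le_1: "x \<in> std_simplex \<Longrightarrow> x $ i \<le> 1"
  using member_le_sum[of i UNIV "\<lambda>i. x $ i"] by (simp add: std_simplex_def)

lemma compact_std_simplex: "compact (std_simplex :: (real ^ 'n::finite) set)"
unfolding compact_eq_bounded_closed
proof
  show "bounded (std_simplex :: (real ^ 'n) set)"
  proof (rule boundedI)
    fix x :: "real ^ 'n" assume "x \<in> std_simplex"
    then show "norm x \<le> 1"
      using norm_le_l1_cart[of x] by (simp add: std_simplex_def)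
  qed
  have eq: "std_simplex = (\<Inter>i. {x :: real ^ 'n. 0 \<le> x $ i}) \<inter> {x. (\<Sum>i\<in>UNIV. x $ i) = 1}"
    by (auto simp: std_simplex_def)
  show "closed (std_simplex :: (real ^ 'n) set)"
    unfolding eq by (intro closed_Int closed_INT ballI closed_Collect_le closed_Collect_eq continuous_intros)
qed

lemma convex_std_simplex: "convex std_simplex"
  by (auto simp: std_simplex_def convex_def sum.distrib simp flip: sum_distrib_left)

lemma std_simplex_nonempty: "std_simplex \<noteq> ({} :: (real ^ 'n::finite) set)"
proof -
  have "(\<chi> i. 1 / real CARD('n)) \<in> (std_simplex :: (real ^ 'n) set)"
    by (simp add: std_simplex_def)
  then show ?thesis by blast
qed

lemma std_simplex_not_0: "x \<in> std_simplex \<Longrightarrow> x \<noteq> 0"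
  by (auto simp: std_simplex_def)

text \<open>The term \<open>\<epsilon>\<close> makes every root \<open>r x i\<close> positive. Hence
  \<open>f\<close> never divides by zero, and its fixed point has only positive coordinates.\<close>

lemma perturbed_eigenpair_exists:
  fixes A :: "'n::finite tensor"
  assumes "nonneg_tensor k A" "k \<ge> 2" "\<epsilon> > 0"
  obtains x \<mu> where "x \<in> std_simplex" "\<And>i. 0 < x $ i" "0 \<le> \<mu>"
    "\<And>i. tensor_apply k A x $ i + \<epsilon> = \<mu> * (x $ i) ^ (k - 1)"
proof -
  define r where "r x i = root (k - 1) (tensor_apply k A x $ i + \<epsilon>)" for x :: "real ^ 'n" and i
  define s where "s x = (\<Sum>i\<in>UNIV. r x i)" for x :: "real ^ 'n"
  define f where "f x = (\<chi> i. r x i / s x)" for x :: "real ^ 'n"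
  have "k - 1 > 0" "k \<ge> 1" using assms by auto
  have pos: "tensor_apply k A x $ i + \<epsilon> > 0" if "x \<in> std_simplex" for x i
    using tensor_apply_nonneg[OF assms(1) \<open>k \<ge> 1\<close>, of x i] that assms(3)
    by (simp add: std_simplex_def add_nonneg_pos)
  have r: "r x i > 0" if "x \<in> std_simplex" for x i
    using pos[OF that] \<open>k - 1 > 0\<close> by (simp add: r_def)
  have s: "s x > 0" if "x \<in> std_simplex" for x
    using r[OF that] by (auto simp: s_def intro!: sum_pos)
  have "continuous_on std_simplex f"
    unfolding f_def s_def r_def using s
    by (intro continuous_intros) (auto simp: s_def r_def less_imp_neq[THEN not_sym])
  moreover have "f \<in> std_simplex \<rightarrow> std_simplex"
  proof
    fix x :: "real ^ 'n" assume x: "x \<in> std_simplex"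
    have "(\<Sum>i\<in>UNIV. r x i / s x) = 1"
      using s[OF x] by (simp add: s_def flip: sum_divide_distrib)
    then show "f x \<in> std_simplex"
      using r[OF x] s[OF x] by (simp add: f_def std_simplex_def less_imp_le)
  qed
  ultimately obtain x where x: "x \<in> std_simplex" and fixpoint: "f x = x"
    using brouwer[OF compact_std_simplex convex_std_simplex std_simplex_nonempty] by metis
  have xi: "r x i = s x * x $ i" for i
  proof -
    have "x $ i = r x i / s x" using fixpoint by (metis f_def vec_lambda_beta)
    then show ?thesis using s[OF x] by simp
  qed
  show thesis
  proof (rule that[OF x])
    show "0 < x $ i" for i
      using r[OF x, of i] s[OF x] by (simp add: xi zero_less_mult_iff)
    \<comment> \<open>The eigenvalue is \<open>s x ^ (k - 1)\<close>: raising
      \<open>r x i = s x * x $ i\<close> to the power \<open>k - 1\<close> removes the root.\<close>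
    show "0 \<le> s x ^ (k - 1)" using s[OF x] by simp
    show "tensor_apply k A x $ i + \<epsilon> = s x ^ (k - 1) * (x $ i) ^ (k - 1)" for i
    proof -
      have "r x i ^ (k - 1) = tensor_apply k A x $ i + \<epsilon>"
        unfolding r_def using pos[OF x, of i] \<open>k - 1 > 0\<close> by simp
      then show ?thesis by (simp add: xi power_mult_distrib)
    qed
  qed
qed

text \<open>Some coordinate of \<open>x\<close> is at least the mean \<open>1 / CARD('n)\<close>;
  the equation at that coordinate bounds \<open>\<mu>\<close>. For \<open>\<epsilon> \<le> 1\<close>
  the bound can be made uniform, as the limit argument needs.\<close>

lemma perturbed_eigenvalue_le:
  fixes A :: "'n::finite tensor"
  assumes "nonneg_tensor k A" "k \<ge> 1" "x \<in> std_simplex" "0 \<le> \<mu>"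
    and eq: "\<And>i. tensor_apply k A x $ i + \<epsilon> = \<mu> * (x $ i) ^ (k - 1)"
  shows "\<mu> \<le> (max_row_sum k A + \<epsilon>) * real CARD('n) ^ (k - 1)"
proof -
  let ?n = "real CARD('n)"
  have "\<exists>i. 1 / ?n \<le> x $ i"
  proof (rule ccontr)
    assume "\<nexists>i. 1 / ?n \<le> x $ i"
    then have "(\<Sum>i\<in>UNIV. x $ i) < (\<Sum>i\<in>(UNIV :: 'n set). 1 / ?n)"
      by (intro sum_strict_mono) (auto simp: not_le)
    then show False using assms(3) by (simp add: std_simplex_def)
  qed
  then obtain i where i: "1 / ?n \<le> x $ i" ..
  have "\<bar>x $ j\<bar> \<le> 1" for j
    using assms(3) std_simplex_le_1[OF assms(3)] by (simp add: std_simplex_def)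
  then have "\<bar>tensor_apply k A x $ i\<bar> \<le> row_sum k A i * 1 ^ (k - 1)"
    by (rule abs_tensor_apply_le[OF assms(1,2)])
  then have "tensor_apply k A x $ i \<le> max_row_sum k A"
    using row_sum_le_max_row_sum[of k A i] by simp
  moreover have "\<mu> * (1 / ?n) ^ (k - 1) \<le> \<mu> * (x $ i) ^ (k - 1)"
    using i assms(4) by (intro mult_left_mono power_mono) auto
  ultimately have "\<mu> * (1 / ?n) ^ (k - 1) \<le> max_row_sum k A + \<epsilon>"
    using eq[of i] by linarith
  then show ?thesis
    by (simp add: power_divide field_simps)
qed

section \<open>The form of a symmetric tensor\<close>

text \<open>Swapping positions \<open>0\<close> and \<open>j\<close> is a self-inverse reindexing
  that preserves the entry of \<open>A\<close> and the product. It moves the weight to the first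
  index, where the rest of the sum becomes \<open>tensor_apply\<close>.\<close>

lemma symmetric_tensor_sum_nth:
  fixes A :: "'n::finite tensor" and y w :: "'n \<Rightarrow> real"
  assumes "symmetric_tensor k A" "j < k"
  shows "(\<Sum>is | length is = k. A is * (\<Prod>i\<leftarrow>is. y i) * w (is ! j))
       = (\<Sum>is | length is = k. A is * (\<Prod>i\<leftarrow>is. y i) * w (is ! 0))"
proof -
  let ?\<pi> = "Transposition.transpose 0 j"
  have perm: "?\<pi> permutes {..<k}"
    using assms(2) by (intro permutes_swap_id) auto
  show ?thesis
  proof (rule sum.reindex_bij_witness[where i = "permute_list ?\<pi>" and j = "permute_list ?\<pi>"])
    fix "is" :: "'n list" assume "is \<in> {is. length is = k}"
    then have len: "length is = k" by simp
    then have perm': "?\<pi> permutes {..<length is}" using perm by simp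
    show invol: "permute_list ?\<pi> (permute_list ?\<pi> is) = is"
      using permute_list_compose[OF perm', of ?\<pi>] by simp
    show "permute_list ?\<pi> is \<in> {is. length is = k}" using len by simp
    have "mset (map y (permute_list ?\<pi> is)) = mset (map y is)"
      using perm' by simp
    then have "(\<Prod>i\<leftarrow>permute_list ?\<pi> is. y i) = (\<Prod>i\<leftarrow>is. y i)"
      by (metis prod_mset_prod_list)
    moreover have "permute_list ?\<pi> is ! 0 = is ! j"
      using permute_list_nth[OF perm', of 0] assms(2) len by simp
    moreover have "A (permute_list ?\<pi> is) = A is"
      using assms(1) len perm by (simp add: symmetric_tensor_def)
    ultimately show "A (permute_list ?\<pi> is) * (\<Prod>i\<leftarrow>permute_list ?\<pi> is. y i) * w (permute_list ?\<pi> is ! 0)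
        = A is * (\<Prod>i\<leftarrow>is. y i) * w (is ! j)" by simp
  next
    fix "is" :: "'n list" assume "is \<in> {is. length is = k}"
    then have len: "length is = k" by simp
    then have perm': "?\<pi> permutes {..<length is}" using perm by simp
    show "permute_list ?\<pi> (permute_list ?\<pi> is) = is"
      using permute_list_compose[OF perm', of ?\<pi>] by simp
    show "permute_list ?\<pi> is \<in> {is. length is = k}" using len by simp
  qed
qed

text \<open>The ratios \<open>z i / y $ i\<close> are averaged with weights \<open>A is\<close>
  times the product of \<open>y\<close>; by symmetry all \<open>k\<close> positions contribute
  equally. Assuming only an inequality for \<open>y\<close> lets perturbed solutions be used
  directly.\<close>

lemma symmetric_tensor_form_le:
  fixes A :: "'n::finite tensor"
  assumes sym: "symmetric_tensor k A" and nonneg: "nonneg_tensor k A" and "k \<ge> 1"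
    and y: "\<And>i. 0 < y $ i"
    and sub: "\<And>i. tensor_apply k A y $ i \<le> \<mu> * (y $ i) ^ (k - 1)"
    and z: "\<And>i. 0 \<le> z i"
  shows "(\<Sum>is | length is = k. A is * (\<Prod>i\<leftarrow>is. z i)) \<le> \<mu> * (\<Sum>i\<in>UNIV. z i ^ k)"
proof -
  obtain m where k: "k = Suc m" using \<open>k \<ge> 1\<close> by (cases k) auto
  \<comment> \<open>These are the \<open>k\<close>th powers produced by the mean inequality;
    multiplied by \<open>(y $ i) ^ k\<close> they become \<open>z i ^ k\<close>.\<close>
  define w where "w i = (z i / y $ i) ^ k" for i
  let ?P = "\<lambda>is. \<Prod>i\<leftarrow>is. y $ i"
  have "(\<Sum>is | length is = k. A is * (\<Prod>i\<leftarrow>is. z i))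
      \<le> (\<Sum>is | length is = k. A is * (?P is * ((\<Sum>j<k. w (is ! j)) / k)))"
  proof (rule sum_mono)
    fix "is" :: "'n list" assume "is \<in> {is. length is = k}"
    then have len: "length is = k" by simp
    have "(\<Prod>i\<leftarrow>is. z i) = (\<Prod>i\<leftarrow>is. y $ i * (z i / y $ i))"
      using y by (simp add: less_imp_neq[THEN not_sym])
    also have "\<dots> = ?P is * (\<Prod>i\<leftarrow>is. z i / y $ i)" by (rule prod_list_map_mult)
    also have "\<dots> \<le> ?P is * ((\<Sum>j<k. w (is ! j)) / k)"
    proof (rule mult_left_mono)
      have "is \<noteq> []" using len k by auto
      then show "(\<Prod>i\<leftarrow>is. z i / y $ i) \<le> (\<Sum>j<k. w (is ! j)) / k"
        using prod_list_map_le_mean_power[of "is" "\<lambda>i. z i / y $ i"] len y z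
        by (simp add: w_def less_imp_le)
      show "0 \<le> ?P is" using y by (simp add: prod_list_map_nonneg less_imp_le)
    qed
    finally show "A is * (\<Prod>i\<leftarrow>is. z i) \<le> A is * (?P is * ((\<Sum>j<k. w (is ! j)) / k))"
      using nonneg len by (intro mult_left_mono) (simp_all add: nonneg_tensor_def)
  qed
  also have "\<dots> = (\<Sum>is | length is = k. \<Sum>j<k. A is * ?P is * w (is ! j)) / k"
    by (simp add: sum_distrib_left sum_divide_distrib mult.assoc)
  also have "\<dots> = (\<Sum>j<k. \<Sum>is | length is = k. A is * ?P is * w (is ! j)) / k"
    by (subst sum.swap) simp
  also have "\<dots> = (\<Sum>j<k. \<Sum>is | length is = k. A is * ?P is * w (is ! 0)) / k"
    by (intro arg_cong2[where f = "(/)"] sum.cong refl symmetric_tensor_sum_nth[OF sym]) simp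
  also have "\<dots> = (\<Sum>is | length is = k. A is * ?P is * w (is ! 0))"
    using \<open>k \<ge> 1\<close> by simp
  \<comment> \<open>Splitting off the first index leaves one factor \<open>y $ i\<close> outside,
    which later completes \<open>(y $ i) ^ (k - 1)\<close> to a \<open>k\<close>th power.\<close>
  also have "\<dots> = (\<Sum>i\<in>UNIV. w i * y $ i * tensor_apply k A y $ i)"
    by (simp add: k sum_lists_Suc tensor_apply_def sum_distrib_left mult_ac)
  also have "\<dots> \<le> (\<Sum>i\<in>UNIV. w i * y $ i * (\<mu> * (y $ i) ^ (k - 1)))"
    using sub y z by (intro sum_mono mult_left_mono) (auto simp: w_def less_imp_le)
  also have "\<dots> = (\<Sum>i\<in>UNIV. \<mu> * z i ^ k)"
  proof (rule sum.cong[OF refl])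
    fix i
    have "w i * y $ i * (\<mu> * (y $ i) ^ (k - 1)) = \<mu> * (w i * (y $ i) ^ k)"
      by (simp add: k)
    also have "w i * (y $ i) ^ k = z i ^ k"
      using y[of i] by (simp add: w_def power_divide)
    finally show "w i * y $ i * (\<mu> * (y $ i) ^ (k - 1)) = \<mu> * z i ^ k" .
  qed
  finally show ?thesis by (simp add: sum_distrib_left)
qed

section \<open>Passage to the limit\<close>

text \<open>The limit eigenvector may have zero coordinates, so the form inequality is proved for
  the positive vectors \<open>X N\<close> and only then passed to the limit.\<close>

lemma perron_eigenvalue_exists:
  fixes A :: "'n::finite tensor"
  assumes nonneg: "nonneg_tensor k A" and "k \<ge> 2"
  obtains \<mu> where "H_eigenvalue k A \<mu>"
    "\<And>z. symmetric_tensor k A \<Longrightarrow> (\<And>i. 0 \<le> z i) \<Longrightarrow>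
      (\<Sum>is | length is = k. A is * (\<Prod>i\<leftarrow>is. z i)) \<le> \<mu> * (\<Sum>i\<in>UNIV. z i ^ k)"
proof -
  have "k \<ge> 1" using assms by simp
  define \<epsilon> where "\<epsilon> N = 1 / real (Suc N)" for N
  have \<epsilon>: "0 < \<epsilon> N" "\<epsilon> N \<le> 1" for N by (simp_all add: \<epsilon>_def)
  have "\<forall>N. \<exists>x \<mu>. x \<in> std_simplex \<and> (\<forall>i. 0 < x $ i) \<and> 0 \<le> \<mu> \<and>
      (\<forall>i. tensor_apply k A x $ i + \<epsilon> N = \<mu> * (x $ i) ^ (k - 1))"
    using perturbed_eigenpair_exists[OF assms \<epsilon>(1)] by metis
  then obtain X M where X: "\<And>N. X N \<in> std_simplex" and Xpos: "\<And>N i. 0 < X N $ i"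
    and M0: "\<And>N. 0 \<le> M N"
    and eq: "\<And>N i. tensor_apply k A (X N) $ i + \<epsilon> N = M N * (X N $ i) ^ (k - 1)"
    by metis
  \<comment> \<open>Since \<open>\<epsilon> N \<le> 1\<close>, this bounds every \<open>M N\<close>
    and places all pairs in one compact set.\<close>
  define B where "B = (max_row_sum k A + 1) * real CARD('n) ^ (k - 1)"
  have "M N \<le> B" for N
  proof -
    have "M N \<le> (max_row_sum k A + \<epsilon> N) * real CARD('n) ^ (k - 1)"
      by (rule perturbed_eigenvalue_le[OF nonneg \<open>k \<ge> 1\<close> X M0 eq])
    also have "\<dots> \<le> B" unfolding B_def using \<epsilon>(2) by (intro mult_right_mono) simp_all
    finally show ?thesis .
  qed
  then have "(X N, M N) \<in> std_simplex \<times> {0..B}" for N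
    using X M0 by simp
  moreover have "seq_compact (std_simplex \<times> {0..B} :: ((real ^ 'n) \<times> real) set)"
    by (intro compact_imp_seq_compact compact_Times compact_std_simplex compact_Icc)
  ultimately obtain l r where l: "l \<in> std_simplex \<times> {0..B}" and "strict_mono r"
    and lim: "((\<lambda>N. (X N, M N)) \<circ> r) \<longlonglongrightarrow> l"
    using seq_compactE[of "std_simplex \<times> {0..B}" "\<lambda>N. (X N, M N)"] by blast
  obtain x \<mu> where l_eq: "l = (x, \<mu>)" by (cases l)
  have limX: "(\<lambda>N. X (r N)) \<longlonglongrightarrow> x" and limM: "(\<lambda>N. M (r N)) \<longlonglongrightarrow> \<mu>"
    using tendsto_fst[OF lim] tendsto_snd[OF lim] by (simp_all add: l_eq o_def)
  have "\<epsilon> \<longlonglongrightarrow> 0" unfolding \<epsilon>_def by (rule LIMSEQ_Suc[OF lim_1_over_n])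
  then have lim\<epsilon>: "(\<lambda>N. \<epsilon> (r N)) \<longlonglongrightarrow> 0"
    using LIMSEQ_subseq_LIMSEQ[of \<epsilon> 0 r] \<open>strict_mono r\<close> by (simp add: o_def)
  have limA: "(\<lambda>N. tensor_apply k A (X (r N))) \<longlonglongrightarrow> tensor_apply k A x"
    by (rule continuous_on_tendsto_compose[OF continuous_on_tensor_apply[OF continuous_on_id, of UNIV] limX])
      simp_all
  have "tensor_apply k A x $ i = \<mu> * (x $ i) ^ (k - 1)" for i
  proof (rule LIMSEQ_unique)
    show "(\<lambda>N. tensor_apply k A (X (r N)) $ i + \<epsilon> (r N)) \<longlonglongrightarrow> tensor_apply k A x $ i"
      using tendsto_add[OF tendsto_vec_nth[OF limA] lim\<epsilon>] by simp
    show "(\<lambda>N. tensor_apply k A (X (r N)) $ i + \<epsilon> (r N)) \<longlonglongrightarrow> \<mu> * (x $ i) ^ (k - 1)"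
      unfolding eq by (intro tendsto_intros limM limX)
  qed
  then have "H_eigenvalue k A \<mu>"
    \<comment> \<open>The simplex is closed, so the limit \<open>x\<close> stays in it and cannot
      vanish.\<close>
    using l std_simplex_not_0[of x]
    by (auto simp: H_eigenvalue_def vec_eq_iff vec_power_def l_eq intro!: exI[of _ x])
  moreover have "(\<Sum>is | length is = k. A is * (\<Prod>i\<leftarrow>is. z i)) \<le> \<mu> * (\<Sum>i\<in>UNIV. z i ^ k)"
    if sym: "symmetric_tensor k A" and z: "\<And>i. 0 \<le> z i" for z
  proof (rule LIMSEQ_le_const)
    show "(\<lambda>N. M (r N) * (\<Sum>i\<in>UNIV. z i ^ k)) \<longlonglongrightarrow> \<mu> * (\<Sum>i\<in>UNIV. z i ^ k)"
      by (intro tendsto_intros limM)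
    \<comment> \<open>Dropping the positive term \<open>\<epsilon> N\<close> turns the perturbed
      equation into the inequality required of \<open>y\<close>.\<close>
    have sub: "tensor_apply k A (X N) $ i \<le> M N * (X N $ i) ^ (k - 1)" for N i
      using eq[of N i] \<epsilon>(1)[of N] by linarith
    show "\<exists>N. \<forall>n\<ge>N. (\<Sum>is | length is = k. A is * (\<Prod>i\<leftarrow>is. z i)) \<le> M (r n) * (\<Sum>i\<in>UNIV. z i ^ k)"
      using symmetric_tensor_form_le[OF sym nonneg \<open>k \<ge> 1\<close> Xpos sub, of z] z by blast
  qed
  ultimately show thesis using that by blast
qed

section \<open>Test vectors and the two lower bounds\<close>

text \<open>For the all-ones vector the form is the sum of all entries, that is, of all row sums,
  and the right side is \<open>\<mu> * CARD('n)\<close>.\<close>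

lemma avg_row_sum_le:
  fixes A :: "'n::finite tensor"
  assumes "k \<ge> 1"
    and "(\<Sum>is | length is = k. A is * (\<Prod>i\<leftarrow>is. 1)) \<le> \<mu> * (\<Sum>i\<in>(UNIV :: 'n set). 1 ^ k)"
  shows "avg_row_sum k A \<le> \<mu>"
proof -
  obtain m where k: "k = Suc m" using \<open>k \<ge> 1\<close> by (cases k) auto
  have [simp]: "(\<Prod>i\<leftarrow>is. 1 :: real) = 1" for "is" :: "'n list" by (induction "is") simp_all
  have "(\<Sum>is | length is = k. A is) = (\<Sum>i\<in>UNIV. row_sum k A i)"
    by (simp add: k sum_lists_Suc row_sum_def)
  then show ?thesis using assms by (simp add: avg_row_sum_def divide_le_eq)
qed

lemma max_diag_le:
  fixes A :: "'n::finite tensor"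
  assumes "nonneg_tensor k A" "k \<ge> 1"
    and le: "\<And>z. (\<And>i. 0 \<le> z i) \<Longrightarrow>
      (\<Sum>is | length is = k. A is * (\<Prod>i\<leftarrow>is. z i)) \<le> \<mu> * (\<Sum>i\<in>UNIV. z i ^ k)"
  shows "max_diag k A \<le> \<mu>"
proof -
  have "A (replicate k i) \<le> \<mu>" for i
  proof -
    let ?z = "\<lambda>j. of_bool (j = i) :: real"
    have "A (replicate k i) = A (replicate k i) * (\<Prod>j\<leftarrow>replicate k i. ?z j)"
      by simp
    \<comment> \<open>All terms are nonnegative, so the diagonal term is at most the whole
      sum.\<close>
    also have "\<dots> \<le> (\<Sum>is | length is = k. A is * (\<Prod>j\<leftarrow>is. ?z j))"
      using assms(1)
      by (intro member_le_sum[where f = "\<lambda>is. A is * (\<Prod>j\<leftarrow>is. ?z j)"] mult_nonneg_nonneg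
          prod_list_map_nonneg) (auto simp: nonneg_tensor_def)
    also have "\<dots> \<le> \<mu> * (\<Sum>j\<in>UNIV. ?z j ^ k)" by (rule le) simp
    \<comment> \<open>Here \<open>k \<ge> 1\<close> matters, because
      \<open>0 ^ 0 = 1\<close>.\<close>
    also have "(\<Sum>j\<in>UNIV. ?z j ^ k) = (\<Sum>j\<in>UNIV. if j = i then 1 else 0)"
      using \<open>k \<ge> 1\<close> by (intro sum.cong) auto
    finally show ?thesis by simp
  qed
  then show ?thesis by (simp add: max_diag_def)
qed

theorem theorem3:
  fixes A :: "'n::finite tensor" and k :: nat
  assumes "k \<ge> 2" and "nonneg_tensor k A"
  shows "lambda_max k A \<le> max_row_sum k A \<and>
    (symmetric_tensor k A \<longrightarrow> lambda_max k A \<ge> max (avg_row_sum k A) (max_diag k A))"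
proof -
  have "k \<ge> 1" using assms by simp
  obtain \<mu> where \<mu>: "H_eigenvalue k A \<mu>"
    and form: "\<And>z. symmetric_tensor k A \<Longrightarrow> (\<And>i. 0 \<le> z i) \<Longrightarrow>
      (\<Sum>is | length is = k. A is * (\<Prod>i\<leftarrow>is. z i)) \<le> \<mu> * (\<Sum>i\<in>UNIV. z i ^ k)"
    using perron_eigenvalue_exists[OF assms(2,1)] by blast
  \<comment> \<open>The eigenvalue \<open>\<mu>\<close> shows that the compact set is nonempty, so a
    largest element \<open>\<nu>\<close> exists. Lower bounds for \<open>\<mu>\<close> carry over
    through \<open>\<mu> \<le> \<nu>\<close>, whether or not the two coincide.\<close>
  then obtain \<nu> where \<nu>: "H_eigenvalue k A \<nu>" "\<And>\<mu>. H_eigenvalue k A \<mu> \<Longrightarrow> \<mu> \<le> \<nu>"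
    using compact_attains_sup[OF compact_H_eigenvalues[OF assms(2) \<open>k \<ge> 1\<close>]] by blast
  then have lambda: "lambda_max k A = \<nu>"
    unfolding lambda_max_def by (intro Greatest_equality)
  have "\<nu> \<le> max_row_sum k A"
    using abs_H_eigenvalue_le_max_row_sum[OF assms(2) \<open>k \<ge> 1\<close> \<nu>(1)] by simp
  moreover have "max (avg_row_sum k A) (max_diag k A) \<le> \<nu>" if "symmetric_tensor k A"
  proof -
    have "avg_row_sum k A \<le> \<mu>"
      by (rule avg_row_sum_le[OF \<open>k \<ge> 1\<close>]) (rule form[OF that], simp)
    moreover have "max_diag k A \<le> \<mu>"
      by (rule max_diag_le[OF assms(2) \<open>k \<ge> 1\<close> form[OF that]])
    ultimately show ?thesis using \<nu>(2)[OF \<mu>] by simp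
  qed
  ultimately show ?thesis by (simp add: lambda)
qed

end
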